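(* Let $\{X_t\}$ be an irreducible, positive-recurrent, discrete-time or continuous-time Markov chain with countably infinite state space $\mathcal{S}$ and stationary distribution $(\pi_j)_{j\in\mathcal{S}}$. For $j\in\mathcal{S}$ let $\theta_j=\inf\{t\ge 0 : X_t=j\}$. Then either 1. $\sum_{j\in\mathcal{S}}\pi_j\,\mathrm{E}_i[\theta_j]$ is equal to a finite constant that is independent of $i\in\mathcal{S}$, or 2. $\sum_{j\in\mathcal{S}}\pi_j\,\mathrm{E}_i[\theta_j]$ is infinite for all $i\in\mathcal{S}$.
   Context: $\mathrm{E}_i[\cdot]$ denotes conditional expectation given $X_0=i$. The chain is time-homogeneous; in discrete time it is indexed by $t\in\{0,1,2,\ldots\}$ and has a transition matrix $P$, and in continuous time it is indexed by $t\in[0,\infty)$ and has a generator $Q$. The stationary distribution is the unique one, which exists by irreducibility and positive recurrence. *)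

theory Defs
  imports "HOL-Probability.Probability"
begin

text \<open>
  In both locales the state space is the type \<open>'s\<close>, and the chain is given with its family of laws:
  \<open>Pr i\<close> is the law under which the chain starts in \<open>i\<close>, so that \<open>E\<^sub>i[Z]\<close> is the
  \<open>[0,\<infinity>]\<close>-valued integral \<open>\<integral>\<^sup>+\<omega>. Z \<omega> \<partial>Pr i\<close>.
  Stochastic matrices are given by their rows: the entry \<open>(i, j)\<close> of the transition
  matrix is \<open>pmf (P i) j\<close>.
\<close>

locale discrete_time_chain =
  fixes P :: "'s::countable \<Rightarrow> 's pmf"
    and Pr :: "'s \<Rightarrow> 'w measure"
    and X :: "nat \<Rightarrow> 'w \<Rightarrow> 's"
  assumes prob_space_Pr: "\<And>i. prob_space (Pr i)"
    and measurable_X: "\<And>i t. X t \<in> measurable (Pr i) (count_space UNIV)"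
    and initial_state: "\<And>i. AE \<omega> in Pr i. X 0 \<omega> = i"
    and markov_property: "\<And>i n x y.
      \<P>(\<omega> in Pr i. \<forall>k\<le>n. X k \<omega> = x k) \<noteq> 0 \<Longrightarrow>
      \<P>(\<omega> in Pr i. X (Suc n) \<omega> = y \<bar> \<forall>k\<le>n. X k \<omega> = x k) = pmf (P (x n)) y"

text \<open>
  Only \<open>p t\<close> and \<open>X t\<close> with \<open>t \<ge> 0\<close> matter. The generator is the entrywise right
  derivative of the transition semigroup at \<open>0\<close>. Paths are right-continuous for the discrete
  topology on the state space.
\<close>

locale continuous_time_chain =
  fixes Q :: "'s::countable \<Rightarrow> 's \<Rightarrow> real"
    and p :: "real \<Rightarrow> 's \<Rightarrow> 's pmf"
    and Pr :: "'s \<Rightarrow> 'w measure"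
    and X :: "real \<Rightarrow> 'w \<Rightarrow> 's"
  assumes semigroup_0: "\<And>i. p 0 i = return_pmf i"
    and semigroup_add: "\<And>s t i. 0 \<le> s \<Longrightarrow> 0 \<le> t \<Longrightarrow> p (s + t) i = bind_pmf (p s i) (p t)"
    and generator: "\<And>i j. ((\<lambda>t. pmf (p t i) j) has_real_derivative Q i j) (at_right 0)"
    and prob_space_Pr: "\<And>i. prob_space (Pr i)"
    and measurable_X: "\<And>i t. 0 \<le> t \<Longrightarrow> X t \<in> measurable (Pr i) (count_space UNIV)"
    and right_continuous: "\<And>i \<omega> t. \<omega> \<in> space (Pr i) \<Longrightarrow> 0 \<le> t \<Longrightarrow>
      \<forall>\<^sub>F s in at_right t. X s \<omega> = X t \<omega>"
    and initial_state: "\<And>i. AE \<omega> in Pr i. X 0 \<omega> = i"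
    and markov_property: "\<And>i n t s x y.
      0 \<le> t 0 \<Longrightarrow> (\<And>k. k < n \<Longrightarrow> t k < t (Suc k)) \<Longrightarrow> 0 \<le> s \<Longrightarrow>
      \<P>(\<omega> in Pr i. \<forall>k\<le>n. X (t k) \<omega> = x k) \<noteq> 0 \<Longrightarrow>
      \<P>(\<omega> in Pr i. X (t n + s) \<omega> = y \<bar> \<forall>k\<le>n. X (t k) \<omega> = x k) = pmf (p s (x n)) y"

definition irreducible_dt :: "('s \<Rightarrow> 'w measure) \<Rightarrow> (nat \<Rightarrow> 'w \<Rightarrow> 's) \<Rightarrow> bool" where
  "irreducible_dt Pr X \<longleftrightarrow> (\<forall>i j. \<exists>t. \<P>(\<omega> in Pr i. X t \<omega> = j) > 0)"

definition irreducible_ct :: "('s \<Rightarrow> 'w measure) \<Rightarrow> (real \<Rightarrow> 'w \<Rightarrow> 's) \<Rightarrow> bool" where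
  "irreducible_ct Pr X \<longleftrightarrow> (\<forall>i j. \<exists>t\<ge>0. \<P>(\<omega> in Pr i. X t \<omega> = j) > 0)"

text \<open>All random times take values in \<open>[0,\<infinity>]\<close>; the infimum of the empty set is \<open>\<infinity>\<close>.\<close>

definition hitting_time_dt :: "(nat \<Rightarrow> 'w \<Rightarrow> 's) \<Rightarrow> 's \<Rightarrow> 'w \<Rightarrow> ennreal" where
  "hitting_time_dt X j \<omega> = (INF t \<in> {t. X t \<omega> = j}. of_nat t)"

definition hitting_time_ct :: "(real \<Rightarrow> 'w \<Rightarrow> 's) \<Rightarrow> 's \<Rightarrow> 'w \<Rightarrow> ennreal" where
  "hitting_time_ct X j \<omega> = (INF t \<in> {t. 0 \<le> t \<and> X t \<omega> = j}. ennreal t)"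

definition return_time_dt :: "(nat \<Rightarrow> 'w \<Rightarrow> 's) \<Rightarrow> 's \<Rightarrow> 'w \<Rightarrow> ennreal" where
  "return_time_dt X j \<omega> = (INF t \<in> {t. 1 \<le> t \<and> X t \<omega> = j}. of_nat t)"

definition first_jump_time :: "(real \<Rightarrow> 'w \<Rightarrow> 's) \<Rightarrow> 'w \<Rightarrow> ennreal" where
  "first_jump_time X \<omega> = (INF t \<in> {t. 0 \<le> t \<and> X t \<omega> \<noteq> X 0 \<omega>}. ennreal t)"

definition return_time_ct :: "(real \<Rightarrow> 'w \<Rightarrow> 's) \<Rightarrow> 's \<Rightarrow> 'w \<Rightarrow> ennreal" where
  "return_time_ct X j \<omega> =
     (INF t \<in> {t. 0 \<le> t \<and> first_jump_time X \<omega> < ennreal t \<and> X t \<omega> = j}. ennreal t)"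

definition positive_recurrent_dt :: "('s \<Rightarrow> 'w measure) \<Rightarrow> (nat \<Rightarrow> 'w \<Rightarrow> 's) \<Rightarrow> bool" where
  "positive_recurrent_dt Pr X \<longleftrightarrow> (\<forall>j. (\<integral>\<^sup>+\<omega>. return_time_dt X j \<omega> \<partial>Pr j) < \<infinity>)"

text \<open>
  An absorbing state, which is conventionally also called positive recurrent, fails this
  condition; an irreducible chain with more than one state has no absorbing state.
\<close>

definition positive_recurrent_ct :: "('s \<Rightarrow> 'w measure) \<Rightarrow> (real \<Rightarrow> 'w \<Rightarrow> 's) \<Rightarrow> bool" where
  "positive_recurrent_ct Pr X \<longleftrightarrow> (\<forall>j. (\<integral>\<^sup>+\<omega>. return_time_ct X j \<omega> \<partial>Pr j) < \<infinity>)"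

definition stationary_dt :: "('s \<Rightarrow> 's pmf) \<Rightarrow> 's pmf \<Rightarrow> bool" where
  "stationary_dt P \<pi> \<longleftrightarrow> bind_pmf \<pi> P = \<pi>"

definition stationary_ct :: "(real \<Rightarrow> 's \<Rightarrow> 's pmf) \<Rightarrow> 's pmf \<Rightarrow> bool" where
  "stationary_ct p \<pi> \<longleftrightarrow> (\<forall>t\<ge>0. bind_pmf \<pi> (p t) = \<pi>)"

end

theory Submission imports Defs begin

text \<open>
  Write \<open>h\<^sub>j i = E\<^sub>i[\<theta>\<^sub>j]\<close> and \<open>K = (\<Sum>j. \<pi>\<^sub>j h\<^sub>j)\<close>. In discrete time, first step analysis gives
  \<open>P h\<^sub>j + 1 = h\<^sub>j\<close> off \<open>j\<close>, with an additional term at \<open>j\<close>, the mean return time, which is at most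
  \<open>1 / \<pi>\<^sub>j\<close>. Weighting by \<open>\<pi>\<^sub>j\<close> and summing over \<open>j\<close> gives \<open>P K + 1 \<le> K + 1\<close>: the \<open>[0,\<infinity>]\<close>-valued
  function \<open>K\<close> is superharmonic. An irreducible kernel with an invariant distribution has no
  superharmonic functions \<open>\<ge> 0\<close> other than constants.

  In continuous time, the inequality for each single \<open>j\<close> is iterated along the skeleton of mesh
  \<open>2\<^sup>-\<^sup>m\<close> up to time \<open>1\<close>. By right-continuity of the paths, the hitting times of the skeletons
  decrease to that of the chain as \<open>m \<rightarrow> \<infinity>\<close>, and \<open>K\<close> is superharmonic for the transition kernel at
  time \<open>1\<close>. The limit has to be taken before the sum over \<open>j\<close>, because the skeletons may have an
  infinite constant although that of the chain is finite.
\<close>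

section \<open>Hitting times of a stochastic kernel\<close>

text \<open>Probability that a chain with kernel \<open>P\<close> started at \<open>i\<close> misses
  \<open>j\<close> at all times 0 to \<open>n\<close>, time 0 included. The first-step recursion
  involves only the kernel, so it serves discrete chains and the skeletons of continuous-time chains
  alike.\<close>

primrec avoid :: "('s \<Rightarrow> 's pmf) \<Rightarrow> 's \<Rightarrow> nat \<Rightarrow> 's \<Rightarrow> ennreal" where
  "avoid P j 0 i = indicator (- {j}) i"
| "avoid P j (Suc n) i = indicator (- {j}) i * (\<integral>\<^sup>+k. avoid P j n k \<partial>P i)"

text \<open>Tail-sum formula: \<open>avoid P j n i\<close> is the probability that the hitting time
  of \<open>j\<close> exceeds \<open>n\<close>.\<close>

definition mean_hit :: "('s \<Rightarrow> 's pmf) \<Rightarrow> 's \<Rightarrow> 's \<Rightarrow> ennreal" where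
  "mean_hit P j i = (\<Sum>n. avoid P j n i)"

lemma avoid_self [simp]: "avoid P j n j = 0"
  by (cases n) auto

lemma mean_hit_self [simp]: "mean_hit P j j = 0"
  by (simp add: mean_hit_def)

lemma nn_integral_mean_hit:
  "(\<integral>\<^sup>+k. mean_hit P j k \<partial>measure_pmf q) = (\<Sum>n. \<integral>\<^sup>+k. avoid P j n k \<partial>measure_pmf q)"
  unfolding mean_hit_def by (rule nn_integral_suminf) simp

lemma mean_hit_step:
  assumes "i \<noteq> j"
  shows "mean_hit P j i = 1 + (\<integral>\<^sup>+k. mean_hit P j k \<partial>P i)"
proof -
  have "mean_hit P j i = avoid P j 0 i + (\<Sum>n. avoid P j (Suc n) i)"
    unfolding mean_hit_def using suminf_offset[of "\<lambda>n. avoid P j n i" 1] by simp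
  then show ?thesis
    using assms by (simp add: nn_integral_mean_hit)
qed

text \<open>Passes from the unordered sums of the theorem to counting-measure integrals, where
  Tonelli and Fatou apply. Enumerating the infinite countable type by the naturals turns both sides
  into the same series.\<close>

lemma infsum_eq_nn_integral:
  fixes f :: "'s::countable \<Rightarrow> ennreal"
  assumes "infinite (UNIV :: 's set)"
  shows "(\<Sum>\<^sub>\<infinity>j. f j) = (\<integral>\<^sup>+j. f j \<partial>count_space UNIV)"
proof -
  have bij: "bij_betw (from_nat_into (UNIV :: 's set)) UNIV UNIV"
    using assms by (intro bij_betw_from_nat_into) auto
  have "(\<integral>\<^sup>+j. f j \<partial>count_space UNIV) = (\<Sum>n. f (from_nat_into UNIV n))"
    by (simp add: nn_integral_bij_count_space[OF bij, symmetric] nn_integral_count_space_nat)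
  also have "\<dots> = (\<Sum>\<^sub>\<infinity>n. f (from_nat_into UNIV n))"
    by (rule sums_unique[symmetric, OF has_sum_imp_sums[OF has_sum_infsum]])
      (simp add: nonneg_summable_on_complete)
  also have "\<dots> = (\<Sum>\<^sub>\<infinity>j. f j)"
    by (rule infsum_reindex_bij_betw[OF bij])
  finally show ?thesis ..
qed

lemma nn_integral_weighted_sum:
  fixes h :: "'a::countable \<Rightarrow> 'b::countable \<Rightarrow> ennreal" and c :: "'a \<Rightarrow> ennreal"
  shows "(\<integral>\<^sup>+x. (\<integral>\<^sup>+j. c j * h j x \<partial>count_space UNIV) \<partial>measure_pmf q)
    = (\<integral>\<^sup>+j. c j * (\<integral>\<^sup>+x. h j x \<partial>measure_pmf q) \<partial>count_space UNIV)"
proof -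
  have "(\<integral>\<^sup>+x. (\<integral>\<^sup>+j. c j * h j x \<partial>count_space UNIV) \<partial>measure_pmf q)
      = (\<integral>\<^sup>+x. (\<integral>\<^sup>+j. ennreal (pmf q x) * (c j * h j x) \<partial>count_space UNIV) \<partial>count_space UNIV)"
    by (simp add: nn_integral_measure_pmf nn_integral_cmult)
  also have "\<dots> = (\<integral>\<^sup>+j. (\<integral>\<^sup>+x. ennreal (pmf q x) * (c j * h j x) \<partial>count_space UNIV) \<partial>count_space UNIV)"
    by (rule nn_integral_count_space_nn_integral) auto
  also have "\<dots> = (\<integral>\<^sup>+j. c j * (\<integral>\<^sup>+x. h j x \<partial>measure_pmf q) \<partial>count_space UNIV)"
    by (simp add: mult.left_commute[of _ "c _"] nn_integral_cmult nn_integral_measure_pmf)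
  finally show ?thesis .
qed

section \<open>Kernels with an invariant distribution: Kac's inequality, finite means, superharmonic
  functions\<close>

locale stationary_kernel =
  fixes P :: "'s::countable \<Rightarrow> 's pmf" and \<pi> :: "'s pmf"
  assumes stationary: "bind_pmf \<pi> P = \<pi>"
    and irreducible: "\<And>i j. (i, j) \<in> {(x, y). y \<in> set_pmf (P x)}\<^sup>*"
begin

lemma nn_integral_stationary: "(\<integral>\<^sup>+x. \<integral>\<^sup>+y. f y \<partial>P x \<partial>\<pi>) = (\<integral>\<^sup>+x. f x \<partial>\<pi>)"
  using nn_integral_bind_pmf[of \<pi> P f] by (simp add: stationary)

text \<open>The support of \<open>\<pi>\<close> is nonempty and, by invariance, closed under
  transitions.\<close>

lemma set_pmf_stationary: "set_pmf \<pi> = UNIV"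
proof -
  obtain i where i: "i \<in> set_pmf \<pi>"
    using set_pmf_not_empty[of \<pi>] by blast
  have "j \<in> set_pmf \<pi>" for j
    using irreducible[of i j]
  proof induction
    case (step x y)
    then have "y \<in> set_pmf (bind_pmf \<pi> P)"
      by auto
    then show ?case
      by (simp add: stationary)
  qed (fact i)
  then show ?thesis by auto
qed

lemma pmf_stationary_pos: "pmf \<pi> j > 0"
  using set_pmf_stationary by (simp add: pmf_positive)

text \<open>
  Half of Kac's formula. Integrating the recursion of \<open>avoid\<close> against \<open>\<pi>\<close> telescopes, because
  \<open>\<pi>\<close> is invariant and the recursion fails only at \<open>j\<close>.
\<close>

lemma kac_le: "ennreal (pmf \<pi> j) * (1 + (\<integral>\<^sup>+k. mean_hit P j k \<partial>P j)) \<le> 1"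
proof -
  define r where "r n = (\<integral>\<^sup>+k. avoid P j n k \<partial>P j)" for n
  define s where "s n = (\<integral>\<^sup>+x. avoid P j n x \<partial>\<pi>)" for n
  have s_Suc: "s n = s (Suc n) + ennreal (pmf \<pi> j) * r n" for n
  proof -
    have "s n = (\<integral>\<^sup>+x. (\<integral>\<^sup>+y. avoid P j n y \<partial>P x) \<partial>\<pi>)"
      by (simp add: s_def nn_integral_stationary)
    also have "\<dots> = (\<integral>\<^sup>+x. avoid P j (Suc n) x + r n * indicator {j} x \<partial>\<pi>)"
      by (intro nn_integral_cong) (auto simp: r_def split: split_indicator)
    also have "\<dots> = s (Suc n) + r n * emeasure \<pi> {j}"
      unfolding s_def by (subst nn_integral_add) (simp_all del: avoid.simps add: nn_integral_cmult)
    finally show ?thesis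
      by (simp add: emeasure_pmf_single mult.commute)
  qed
  \<comment> \<open>The remainder \<open>s N\<close>, the \<open>\<pi>\<close>-probability of
    missing \<open>j\<close> up to time \<open>N\<close>, makes the total exactly 1; dropping it
    bounds the partial sums.\<close>
  have tele: "ennreal (pmf \<pi> j) + ((\<Sum>n<N. ennreal (pmf \<pi> j) * r n) + s N) = 1" for N
  proof (induction N)
    case 0
    have "emeasure \<pi> {j} + emeasure \<pi> (- {j}) = emeasure \<pi> ({j} \<union> - {j})"
      by (rule plus_emeasure) auto
    moreover have "s 0 = emeasure \<pi> (- {j})"
      by (simp add: s_def)
    ultimately show ?case
      by (simp add: emeasure_pmf_single)
  next
    case (Suc N)
    then show ?case
      using s_Suc[of N] by (simp add: ac_simps)
  qed
  have "ennreal (pmf \<pi> j) + (\<Sum>n. ennreal (pmf \<pi> j) * r n) \<le> 1"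
  proof -
    have "(\<lambda>N. ennreal (pmf \<pi> j) + (\<Sum>n<N. ennreal (pmf \<pi> j) * r n))
        \<longlonglongrightarrow> ennreal (pmf \<pi> j) + (\<Sum>n. ennreal (pmf \<pi> j) * r n)"
      by (intro tendsto_intros summable_LIMSEQ) auto
    moreover have "ennreal (pmf \<pi> j) + (\<Sum>n<N. ennreal (pmf \<pi> j) * r n) \<le> 1" for N
      using tele[of N] by (metis add.assoc le_iff_add)
    ultimately show ?thesis
      using LIMSEQ_le_const2 by blast
  qed
  then show ?thesis
    by (simp add: nn_integral_mean_hit r_def distrib_left)
qed

text \<open>Off \<open>j\<close> this is first-step analysis, with equality; at \<open>j\<close>,
  where \<open>mean_hit\<close> vanishes, it is Kac's inequality. With the weight
  \<open>pmf \<pi> j\<close> the excess is at most an indicator, and these indicators sum to 1 over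
  \<open>j\<close>.\<close>

lemma mean_hit_drift:
  "ennreal (pmf \<pi> j) * ((\<integral>\<^sup>+k. mean_hit P j k \<partial>P i) + 1)
     \<le> ennreal (pmf \<pi> j) * mean_hit P j i + indicator {j} i"
  using kac_le[of j] mean_hit_step[of i j P] by (cases "i = j") (auto simp: add.commute)

text \<open>Finiteness spreads along edges from \<open>j\<close>, where the value is 0. The mean
  over the next state is finite by Kac's inequality at \<open>j\<close> and by the first-step
  equation elsewhere, and it dominates each successor's value times a positive probability.\<close>

lemma mean_hit_finite: "mean_hit P j i < \<infinity>"
  using irreducible[of j i]
proof induction
  case (step x y)
  have "(\<integral>\<^sup>+k. mean_hit P j k \<partial>P x) < \<infinity>"
  proof (cases "x = j")
    case True
    have "ennreal (pmf \<pi> j) * (1 + (\<integral>\<^sup>+k. mean_hit P j k \<partial>P j)) < \<infinity>"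
      using kac_le[of j] by (rule le_less_trans) simp
    then show ?thesis
      using pmf_stationary_pos[of j] True by (auto simp: ennreal_mult_less_top)
  next
    case False
    then show ?thesis
      using step.IH mean_hit_step[of x j P] by simp
  qed
  moreover have "ennreal (pmf (P x) y) * mean_hit P j y \<le> (\<integral>\<^sup>+k. mean_hit P j k \<partial>P x)"
  proof -
    have "(\<integral>\<^sup>+k. mean_hit P j y * indicator {y} k \<partial>P x) \<le> (\<integral>\<^sup>+k. mean_hit P j k \<partial>P x)"
      by (intro nn_integral_mono) (auto split: split_indicator)
    then show ?thesis
      by (simp add: nn_integral_cmult emeasure_pmf_single mult.commute)
  qed
  ultimately have "ennreal (pmf (P x) y) * mean_hit P j y < \<infinity>"
    by (rule le_less_trans[rotated])
  moreover have "pmf (P x) y > 0"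
    using step.hyps by (simp add: pmf_positive)
  ultimately show ?case
    by (auto simp: ennreal_mult_less_top)
qed simp

text \<open>
  If \<open>K i \<ge> c\<close>, then \<open>v = c - min (K, c)\<close> is a bounded subharmonic function that vanishes at \<open>i\<close>.
  Invariance of \<open>\<pi>\<close> makes \<open>v\<close> harmonic, and a nonnegative harmonic function with a zero is \<open>0\<close>.
\<close>

lemma superharmonic_const:
  assumes super: "\<And>x. (\<integral>\<^sup>+y. K y \<partial>P x) \<le> K x"
  shows "K i = K k"
proof -
  have ge: "c \<le> K k" if c: "c < \<infinity>" "c \<le> K i" for c i k
  proof -
    define v where "v x = c - min (K x) c" for x
    have v_le: "v x \<le> c" for x
      by (simp add: v_def diff_le_self_ennreal)
    have int_v_le: "(\<integral>\<^sup>+y. v y \<partial>measure_pmf q) \<le> c" for q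
      using nn_integral_mono[of q v "\<lambda>_. c"] v_le by simp
    have sub: "v x \<le> (\<integral>\<^sup>+y. v y \<partial>P x)" for x
    proof -
      have fin: "(\<integral>\<^sup>+y. min (K y) c \<partial>P x) \<le> min (K x) c"
        using nn_integral_mono[of "P x" "\<lambda>y. min (K y) c" K] super[of x]
          nn_integral_mono[of "P x" "\<lambda>y. min (K y) c" "\<lambda>_. c"] by (auto intro: order_trans)
      then have "(\<integral>\<^sup>+y. min (K y) c \<partial>P x) \<noteq> \<infinity>"
        using c(1) by (auto simp: top_unique)
      then have "(\<integral>\<^sup>+y. v y \<partial>P x) = c - (\<integral>\<^sup>+y. min (K y) c \<partial>P x)"
        unfolding v_def by (subst nn_integral_diff) auto
      then show ?thesis
        using fin by (simp add: v_def ennreal_minus_mono)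
    qed
    \<comment> \<open>The difference is nonnegative by \<open>sub\<close> and has
      \<open>\<pi>\<close>-integral 0; since \<open>\<pi>\<close> charges every state, it vanishes
      everywhere.\<close>
    have harm: "(\<integral>\<^sup>+y. v y \<partial>P x) = v x" for x
    proof -
      have "(\<integral>\<^sup>+x. ((\<integral>\<^sup>+y. v y \<partial>P x) - v x) \<partial>\<pi>) = (\<integral>\<^sup>+x. (\<integral>\<^sup>+y. v y \<partial>P x) \<partial>\<pi>) - (\<integral>\<^sup>+x. v x \<partial>\<pi>)"
        using int_v_le[of \<pi>] c(1) sub by (intro nn_integral_diff) (auto simp: top_unique)
      also have "\<dots> = 0"
        using int_v_le[of \<pi>] c(1) by (auto simp: nn_integral_stationary top_unique)
      finally have "(\<integral>\<^sup>+y. v y \<partial>P x) - v x = 0"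
        using set_pmf_stationary by (auto simp: nn_integral_0_iff_AE AE_measure_pmf_iff)
      then have "(\<integral>\<^sup>+y. v y \<partial>P x) \<le> v x"
        by (simp add: diff_eq_0_iff_ennreal)
      then show ?thesis
        using sub by (rule antisym)
    qed
    have "v k = 0"
      using irreducible[of i k]
    proof induction
      case base
      then show ?case
        using c by (simp add: v_def min_absorb2)
    next
      case (step x y)
      then have "(\<integral>\<^sup>+y. v y \<partial>P x) = 0"
        by (simp add: harm)
      then show ?case
        using step.hyps by (auto simp: nn_integral_0_iff_AE AE_measure_pmf_iff)
    qed
    then show ?thesis
      by (auto simp: v_def diff_eq_0_iff_ennreal)
  qed
  have "K i \<le> K k" for i k
  proof (rule ccontr)
    assume "\<not> K i \<le> K k"
    \<comment> \<open>A level strictly below \<open>K i\<close> is finite even when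
      \<open>K i\<close> is infinite, so infinite values of \<open>K\<close> are covered
      too.\<close>
    then obtain c where "K k < c" "c < K i"
      using dense[of "K k" "K i"] by (auto simp: not_le)
    then show False
      using ge[of c i k] order.strict_trans2[of c "K i" top] by (simp add: less_imp_le leD)
  qed
  then show ?thesis
    by (intro antisym)
qed

lemma superharmonic_mean_hit:
  "(\<integral>\<^sup>+x. (\<integral>\<^sup>+j. ennreal (pmf \<pi> j) * mean_hit P j x \<partial>count_space UNIV) \<partial>P i)
     \<le> (\<integral>\<^sup>+j. ennreal (pmf \<pi> j) * mean_hit P j i \<partial>count_space UNIV)"
proof -
  let ?K = "\<lambda>x. \<integral>\<^sup>+j. ennreal (pmf \<pi> j) * mean_hit P j x \<partial>count_space UNIV"
  \<comment> \<open>The added 1 is the total mass of \<open>\<pi>\<close>; it cancels against the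
    sum of \<open>indicator {j} i\<close> over \<open>j\<close>.\<close>
  have "(\<integral>\<^sup>+x. ?K x \<partial>P i) + 1
      = (\<integral>\<^sup>+j. ennreal (pmf \<pi> j) * ((\<integral>\<^sup>+x. mean_hit P j x \<partial>P i) + 1) \<partial>count_space UNIV)"
    unfolding nn_integral_weighted_sum by (simp add: distrib_left nn_integral_add nn_integral_pmf)
  also have "\<dots> \<le> (\<integral>\<^sup>+j. ennreal (pmf \<pi> j) * mean_hit P j i + indicator {j} i \<partial>count_space UNIV)"
    by (intro nn_integral_mono mean_hit_drift)
  also have "\<dots> = ?K i + (\<integral>\<^sup>+j. indicator {i} j \<partial>count_space UNIV)"
    by (subst nn_integral_add[symmetric]) (auto intro!: nn_integral_cong split: split_indicator)
  also have "\<dots> = ?K i + 1"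
    by simp
  finally show ?thesis
    using ennreal_add_left_cancel_le[of 1] by (simp add: add.commute)
qed

end

section \<open>Discrete time\<close>

primrec path_pmf :: "('s \<Rightarrow> 's pmf) \<Rightarrow> nat \<Rightarrow> 's \<Rightarrow> 's list pmf" where
  "path_pmf P 0 i = return_pmf [i]"
| "path_pmf P (Suc n) i = map_pmf ((#) i) (bind_pmf (P i) (path_pmf P n))"

lemma path_nonempty: "l \<in> set_pmf (path_pmf P n i) \<Longrightarrow> l \<noteq> []"
  by (cases n) auto

text \<open>The recursion of \<open>path_pmf\<close> prepends the first state, as suits
  \<open>avoid\<close>, while the Markov property appends a last one. Both decompositions give the
  same law.\<close>

lemma path_snoc:
  "path_pmf P (Suc n) i = bind_pmf (path_pmf P n i) (\<lambda>l. map_pmf (\<lambda>y. l @ [y]) (P (last l)))"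
proof (induction n arbitrary: i)
  case 0
  show ?case
    by (simp add: bind_return_pmf map_pmf_def bind_assoc_pmf)
next
  case (Suc n)
  have "path_pmf P (Suc (Suc n)) i = map_pmf ((#) i) (bind_pmf (P i) (\<lambda>k. path_pmf P (Suc n) k))"
    by (rule path_pmf.simps(2))
  also have "\<dots> = map_pmf ((#) i) (bind_pmf (P i)
      (\<lambda>k. bind_pmf (path_pmf P n k) (\<lambda>l. map_pmf (\<lambda>y. l @ [y]) (P (last l)))))"
    by (simp only: Suc)
  also have "\<dots> = bind_pmf (P i)
      (\<lambda>k. bind_pmf (path_pmf P n k) (\<lambda>l. map_pmf (\<lambda>y. i # l @ [y]) (P (last l))))"
    by (simp add: map_bind_pmf pmf.map_comp o_def)
  \<comment> \<open>Here \<open>last l = last (i # l)\<close>, because paths in the support are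
    nonempty.\<close>
  also have "\<dots> = bind_pmf (P i)
      (\<lambda>k. bind_pmf (path_pmf P n k) (\<lambda>l. map_pmf (\<lambda>y. (i # l) @ [y]) (P (last (i # l)))))"
    by (intro bind_pmf_cong refl) (auto dest: path_nonempty)
  also have "\<dots> = bind_pmf (path_pmf P (Suc n) i) (\<lambda>l. map_pmf (\<lambda>y. l @ [y]) (P (last l)))"
    by (simp add: bind_map_pmf bind_assoc_pmf)
  finally show ?case .
qed

lemma pmf_path_snoc: "pmf (path_pmf P (Suc n) i) (l @ [y]) = pmf (path_pmf P n i) l * pmf (P (last l)) y"
proof -
  have *: "pmf (map_pmf (\<lambda>y. l' @ [y]) (P (last l'))) (l @ [y])
      = indicator {l} l' * pmf (P (last l)) y" for l'
  proof (cases "l' = l")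
    case True
    then show ?thesis
      using pmf_map_inj'[of "\<lambda>y. l @ [y]" "P (last l)" y] by (simp add: inj_on_def)
  next
    case False
    then have "l @ [y] \<notin> set_pmf (map_pmf (\<lambda>y. l' @ [y]) (P (last l')))"
      by auto
    then show ?thesis
      using False by (simp add: pmf_eq_0_set_pmf)
  qed
  show ?thesis
    unfolding path_snoc pmf_bind * by (simp add: measure_pmf_single)
qed

lemma path_avoid: "emeasure (path_pmf P n i) {l. j \<notin> set l} = avoid P j n i"
proof (induction n arbitrary: i)
  case 0
  then show ?case
    by (auto split: split_indicator)
next
  case (Suc n)
  have "(#) i -` {l. j \<notin> set l} = (if i = j then {} else {l. j \<notin> set l})"
    by auto
  then show ?case
    by (auto simp: Suc split: split_indicator)
qed

lemma path_last: "l \<in> set_pmf (path_pmf P n i) \<Longrightarrow> (i, last l) \<in> {(x, y). y \<in> set_pmf (P x)}\<^sup>*"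
proof (induction n arbitrary: i l)
  case (Suc n)
  then obtain k l' where "k \<in> set_pmf (P i)" "l' \<in> set_pmf (path_pmf P n k)" "l = i # l'"
    by auto
  then show ?case
    using Suc.IH[of l' k] path_nonempty[of l' P n k]
    by (auto intro: converse_rtrancl_into_rtrancl)
qed simp

context discrete_time_chain
begin

lemma measurable_state [measurable]: "X t \<in> measurable (Pr i) (count_space UNIV)"
  by (rule measurable_X)

lemma path_law_atom:
  "\<P>(\<omega> in Pr i. \<forall>k\<le>n. X k \<omega> = x k) = pmf (path_pmf P n i) (map x [0..<Suc n])"
proof (induction n)
  case 0
  interpret prob_space "Pr i" by (rule prob_space_Pr)
  have "\<P>(\<omega> in Pr i. X 0 \<omega> = x 0) = \<P>(\<omega> in Pr i. i = x 0)"
    using initial_state[of i] by (intro measure_eq_AE) auto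
  then show ?case
    using prob_space by (cases "i = x 0") (auto simp: indicator_def)
next
  case (Suc n)
  interpret prob_space "Pr i" by (rule prob_space_Pr)
  let ?A = "\<P>(\<omega> in Pr i. \<forall>k\<le>n. X k \<omega> = x k)"
  let ?B = "\<P>(\<omega> in Pr i. X (Suc n) \<omega> = x (Suc n) \<and> (\<forall>k\<le>n. X k \<omega> = x k))"
  have "\<P>(\<omega> in Pr i. \<forall>k\<le>Suc n. X k \<omega> = x k) = ?B"
    by (rule arg_cong[where f = "measure (Pr i)"]) (auto simp: le_Suc_eq)
  \<comment> \<open>The Markov property speaks only of histories of positive probability; for a null
    history both sides are 0.\<close>
  also have "?B = ?A * pmf (P (x n)) (x (Suc n))"
  proof (cases "?A = 0")
    case True
    have "?B \<le> ?A"
      by (intro finite_measure_mono) auto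
    then show ?thesis
      using True measure_nonneg[of "Pr i"] by (simp add: antisym)
  next
    case False
    show ?thesis
      using markov_property[OF False, of "x (Suc n)"] False by (simp add: cond_prob_def field_simps)
  qed
  also have "\<dots> = pmf (path_pmf P (Suc n) i) (map x [0..<Suc n] @ [x (Suc n)])"
    by (subst pmf_path_snoc, subst Suc) simp
  finally show ?case
    by simp
qed

lemma map_state_eq:
  "{\<omega> \<in> space (Pr i). map (\<lambda>k. X k \<omega>) [0..<Suc n] = l} =
     (if length l = Suc n then {\<omega> \<in> space (Pr i). \<forall>k\<le>n. X k \<omega> = l ! k} else {})"
  by (auto simp del: upt_Suc simp: list_eq_iff_nth_eq less_Suc_eq_le)

lemma measurable_states [measurable]:
  "(\<lambda>\<omega>. map (\<lambda>k. X k \<omega>) [0..<Suc n]) \<in> measurable (Pr i) (count_space UNIV)"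
  unfolding measurable_count_space_eq_countable[OF countableI_type]
proof (intro conjI ballI)
  fix l :: "'s list"
  have "{\<omega> \<in> space (Pr i). map (\<lambda>k. X k \<omega>) [0..<Suc n] = l} \<in> sets (Pr i)"
    unfolding map_state_eq by auto
  then show "(\<lambda>\<omega>. map (\<lambda>k. X k \<omega>) [0..<Suc n]) -` {l} \<inter> space (Pr i) \<in> sets (Pr i)"
    by (simp add: vimage_def Int_def conj_commute)
qed auto

text \<open>Lists over a countable type form a countable space, so agreement on single paths is
  enough.\<close>

lemma path_law:
  "distr (Pr i) (count_space UNIV) (\<lambda>\<omega>. map (\<lambda>k. X k \<omega>) [0..<Suc n]) = measure_pmf (path_pmf P n i)"
proof (rule measure_eqI_countable)
  fix l :: "'s list"
  interpret prob_space "Pr i" by (rule prob_space_Pr)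
  have len: "length l = Suc n" if "l \<in> set_pmf (path_pmf P n i)"
    using that by (induction n arbitrary: i l) auto
  have "emeasure (distr (Pr i) (count_space UNIV) (\<lambda>\<omega>. map (\<lambda>k. X k \<omega>) [0..<Suc n])) {l}
      = emeasure (Pr i) {\<omega> \<in> space (Pr i). map (\<lambda>k. X k \<omega>) [0..<Suc n] = l}"
    by (subst emeasure_distr) (auto simp del: upt_Suc intro!: arg_cong[where f = "emeasure (Pr i)"])
  also have "\<dots> = pmf (path_pmf P n i) l"
  proof (cases "length l = Suc n")
    case True
    then have "map ((!) l) [0..<Suc n] = l"
      by (metis map_nth)
    then show ?thesis
      unfolding map_state_eq using True path_law_atom[of i n "(!) l"] by (simp add: emeasure_eq_measure)
  next
    case False
    then have "l \<notin> set_pmf (path_pmf P n i)"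
      using len by auto
    then show ?thesis
      unfolding map_state_eq using False by (simp add: pmf_eq_0_set_pmf)
  qed
  finally show "emeasure (distr (Pr i) (count_space UNIV) (\<lambda>\<omega>. map (\<lambda>k. X k \<omega>) [0..<Suc n])) {l}
      = emeasure (measure_pmf (path_pmf P n i)) {l}"
    by (simp add: emeasure_pmf_single)
qed auto

lemma emeasure_path:
  "emeasure (Pr i) {\<omega> \<in> space (Pr i). map (\<lambda>k. X k \<omega>) [0..<Suc n] \<in> A} = emeasure (path_pmf P n i) A"
  by (subst path_law[symmetric], subst emeasure_distr)
    (auto simp del: upt_Suc intro!: arg_cong[where f = "emeasure (Pr i)"])

lemma emeasure_avoid:
  "emeasure (Pr i) {\<omega> \<in> space (Pr i). \<forall>k\<le>n. X k \<omega> \<noteq> j} = avoid P j n i"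
  unfolding path_avoid[symmetric] emeasure_path[symmetric]
  by (rule arg_cong[where f = "emeasure (Pr i)"]) (auto simp del: upt_Suc simp: less_Suc_eq_le)

text \<open>The event \<open>X t \<omega> = j\<close> has positive probability, so some path in the
  support of \<open>path_pmf P t i\<close> ends in \<open>j\<close>, and its steps are
  edges.\<close>

lemma irreducible_kernel:
  assumes "irreducible_dt Pr X"
  shows "(i, j) \<in> {(x, y). y \<in> set_pmf (P x)}\<^sup>*"
proof -
  interpret prob_space "Pr i" by (rule prob_space_Pr)
  obtain t where t: "\<P>(\<omega> in Pr i. X t \<omega> = j) > 0"
    using assms by (auto simp: irreducible_dt_def)
  have "emeasure (path_pmf P t i) {l. last l = j}
      = emeasure (Pr i) {\<omega> \<in> space (Pr i). X t \<omega> = j}"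
    unfolding emeasure_path[symmetric] by (rule arg_cong[where f = "emeasure (Pr i)"]) simp
  then have "emeasure (path_pmf P t i) {l. last l = j} \<noteq> 0"
    using t by (simp add: emeasure_eq_measure)
  then have "set_pmf (path_pmf P t i) \<inter> {l. last l = j} \<noteq> {}"
    using measure_pmf_zero_iff[of "path_pmf P t i" "{l. last l = j}"]
    by (auto simp: measure_pmf.emeasure_eq_measure)
  then show ?thesis
    by (auto dest: path_last)
qed

text \<open>The series counts the \<open>n\<close> below the hitting time, and is infinite if
  \<open>j\<close> is never hit. This form gives measurability and termwise integration.\<close>

lemma hitting_time_dt_eq:
  "hitting_time_dt X j \<omega> = (\<Sum>n. indicator {\<omega>. \<forall>k\<le>n. X k \<omega> \<noteq> j} \<omega>)"
proof (cases "\<exists>t. X t \<omega> = j")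
  case False
  then show ?thesis
    using nn_integral_count_space_nat[of "\<lambda>_. 1"] by (simp add: hitting_time_dt_def)
next
  case True
  define T where "T = (LEAST t. X t \<omega> = j)"
  have T: "X T \<omega> = j"
    using True unfolding T_def by (auto intro: LeastI)
  have less: "n < T \<longleftrightarrow> (\<forall>k\<le>n. X k \<omega> \<noteq> j)" for n
  proof
    assume "n < T"
    then show "\<forall>k\<le>n. X k \<omega> \<noteq> j"
      unfolding T_def by (intro allI impI not_less_Least) (rule le_less_trans)
  next
    assume "\<forall>k\<le>n. X k \<omega> \<noteq> j"
    then have "\<not> T \<le> n"
      using T by auto
    then show "n < T"
      by simp
  qed
  have "hitting_time_dt X j \<omega> = of_nat T"
    unfolding hitting_time_dt_def
  proof (rule antisym)
    show "(INF t\<in>{t. X t \<omega> = j}. of_nat t) \<le> (of_nat T :: ennreal)"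
      using T by (intro INF_lower) simp
    show "(of_nat T :: ennreal) \<le> (INF t\<in>{t. X t \<omega> = j}. of_nat t)"
      by (intro INF_greatest) (simp add: T_def Least_le)
  qed
  moreover have "(\<Sum>n. indicator {\<omega>. \<forall>k\<le>n. X k \<omega> \<noteq> j} \<omega> :: ennreal)
      = (\<Sum>n<T. indicator {\<omega>. \<forall>k\<le>n. X k \<omega> \<noteq> j} \<omega>)"
    by (rule suminf_finite) (auto simp: less[symmetric] split: split_indicator)
  moreover have "\<dots> = of_nat T"
    by (simp add: less[symmetric])
  ultimately show ?thesis
    by simp
qed

lemma borel_measurable_hitting_time [measurable]:
  "hitting_time_dt X j \<in> borel_measurable (Pr i)"
  unfolding hitting_time_dt_eq[abs_def] indicator_def by measurable

lemma nn_integral_hitting_time: "(\<integral>\<^sup>+\<omega>. hitting_time_dt X j \<omega> \<partial>Pr i) = mean_hit P j i"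
proof -
  have "(\<integral>\<^sup>+\<omega>. hitting_time_dt X j \<omega> \<partial>Pr i)
      = (\<integral>\<^sup>+\<omega>. (\<Sum>n. indicator {\<omega> \<in> space (Pr i). \<forall>k\<le>n. X k \<omega> \<noteq> j} \<omega>) \<partial>Pr i)"
    unfolding hitting_time_dt_eq
    by (intro nn_integral_cong suminf_cong) (auto split: split_indicator)
  also have "\<dots> = (\<Sum>n. emeasure (Pr i) {\<omega> \<in> space (Pr i). \<forall>k\<le>n. X k \<omega> \<noteq> j})"
    by (subst nn_integral_suminf) auto
  finally show ?thesis
    by (simp add: emeasure_avoid mean_hit_def)
qed

end

section \<open>Continuous time\<close>

definition dyadic_hitting_time :: "(real \<Rightarrow> 'w \<Rightarrow> 's) \<Rightarrow> 's \<Rightarrow> nat \<Rightarrow> 'w \<Rightarrow> ennreal" where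
  "dyadic_hitting_time X j m \<omega> = ennreal (1 / 2 ^ m) * hitting_time_dt (\<lambda>k. X (real k * (1 / 2 ^ m))) j \<omega>"

lemma mult_INF_ennreal:
  fixes c d :: ennreal
  assumes "c * d = 1"
  shows "c * (INF i\<in>I. f i) = (INF i\<in>I. c * f i)"
proof (rule antisym)
  show "c * (INF i\<in>I. f i) \<le> (INF i\<in>I. c * f i)"
    by (intro INF_greatest mult_left_mono INF_lower) auto
  have "d * (INF i\<in>I. c * f i) \<le> f i" if "i \<in> I" for i
  proof -
    have "d * (INF i\<in>I. c * f i) \<le> d * (c * f i)"
      using that by (intro mult_left_mono INF_lower) auto
    also have "d * (c * f i) = (c * d) * f i"
      by (simp only: ac_simps)
    finally show ?thesis
      by (simp add: assms)
  qed
  then have "c * (d * (INF i\<in>I. c * f i)) \<le> c * (INF i\<in>I. f i)"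
    by (intro mult_left_mono INF_greatest) auto
  then show "(INF i\<in>I. c * f i) \<le> c * (INF i\<in>I. f i)"
    by (simp add: assms flip: mult.assoc)
qed

lemma dyadic_unit: "ennreal (1 / 2 ^ m) * of_nat (2 ^ m) = 1"
  by (simp add: ennreal_of_nat_eq_real_of_nat ennreal_mult[symmetric] flip: ennreal_1)

lemma dyadic_hitting_time_eq:
  "dyadic_hitting_time X j m \<omega> =
     (INF k \<in> {k. X (real k * (1 / 2 ^ m)) \<omega> = j}. ennreal (real k * (1 / 2 ^ m)))"
proof -
  have "ennreal (1 / 2 ^ m) * of_nat k = ennreal (real k * (1 / 2 ^ m))" for k
    by (subst mult.commute, subst ennreal_mult) (auto simp: ennreal_of_nat_eq_real_of_nat)
  then show ?thesis
    unfolding dyadic_hitting_time_def hitting_time_dt_def mult_INF_ennreal[OF dyadic_unit] by simp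
qed

text \<open>Grid point \<open>k\<close> of one mesh is grid point \<open>2 * k\<close> of the next,
  so finer skeletons see every visit that coarser ones see.\<close>

lemma decseq_dyadic_hitting_time: "decseq (dyadic_hitting_time X j)"
proof (intro decseq_SucI le_funI)
  fix m \<omega>
  show "dyadic_hitting_time X j (Suc m) \<omega> \<le> dyadic_hitting_time X j m \<omega>"
    unfolding dyadic_hitting_time_eq
  proof (rule INF_mono)
    fix k assume "k \<in> {k. X (real k * (1 / 2 ^ m)) \<omega> = j}"
    then show "\<exists>k'\<in>{k. X (real k * (1 / 2 ^ Suc m)) \<omega> = j}.
        ennreal (real k' * (1 / 2 ^ Suc m)) \<le> ennreal (real k * (1 / 2 ^ m))"
      by (intro bexI[of _ "2 * k"]) auto
  qed
qed

section \<open>Skeletons of a continuous-time chain and their limit\<close>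

context continuous_time_chain
begin

lemma measurable_state: "0 \<le> t \<Longrightarrow> {\<omega> \<in> space (Pr i). X t \<omega> = j} \<in> sets (Pr i)"
  using measurable_sets[OF measurable_X, of t "{j}" i]
  by (simp add: vimage_def Int_def conj_commute)

lemma skeleton:
  assumes "\<delta> > 0"
  shows "discrete_time_chain (p \<delta>) Pr (\<lambda>k. X (real k * \<delta>))"
proof (rule discrete_time_chain.intro)
  show "prob_space (Pr i)" for i
    by (rule prob_space_Pr)
  show "X (real k * \<delta>) \<in> measurable (Pr i) (count_space UNIV)" for i k
    using assms by (intro measurable_X) simp
  show "AE \<omega> in Pr i. X (real 0 * \<delta>) \<omega> = i" for i
    using initial_state[of i] by simp
  fix i n x y
  assume *: "\<P>(\<omega> in Pr i. \<forall>k\<le>n. X (real k * \<delta>) \<omega> = x k) \<noteq> 0"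
  have Suc: "real (Suc k) * \<delta> = real k * \<delta> + \<delta>" for k
    by (simp add: algebra_simps)
  show "\<P>(\<omega> in Pr i. X (real (Suc n) * \<delta>) \<omega> = y \<bar> \<forall>k\<le>n. X (real k * \<delta>) \<omega> = x k)
      = pmf (p \<delta> (x n)) y"
    unfolding Suc
  proof (rule markov_property)
    show "0 \<le> real 0 * \<delta>"
      by simp
    show "real k * \<delta> < real (Suc k) * \<delta>" for k
      unfolding Suc using assms by simp
  qed (use * assms in simp_all)
qed

lemma prob_state:
  assumes "0 \<le> t"
  shows "\<P>(\<omega> in Pr i. X t \<omega> = j) = pmf (p t i) j"
proof -
  interpret prob_space "Pr i" by (rule prob_space_Pr)
  have [measurable]: "{\<omega> \<in> space (Pr i). X 0 \<omega> = k} \<in> sets (Pr i)"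
      "{\<omega> \<in> space (Pr i). X t \<omega> = k} \<in> sets (Pr i)" for k
    using assms by (auto intro: measurable_state)
  have init: "\<P>(\<omega> in Pr i. X 0 \<omega> = i) = 1"
    using initial_state[of i] by (simp add: prob_Collect_eq_1)
  have "\<P>(\<omega> in Pr i. X t \<omega> = j) = \<P>(\<omega> in Pr i. X t \<omega> = j \<and> X 0 \<omega> = i)"
    using initial_state[of i] by (intro measure_eq_AE) auto
  also have "\<dots> = pmf (p t i) j"
    using markov_property[of real 0 t i "\<lambda>_. i" j] init assms by (simp add: cond_prob_def)
  finally show ?thesis .
qed

lemma set_pmf_add:
  assumes "0 \<le> s" "0 \<le> t" "j \<in> set_pmf (p s i)" "k \<in> set_pmf (p t j)"
  shows "k \<in> set_pmf (p (s + t) i)"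
  using assms by (auto simp: semigroup_add)

text \<open>Differentiability at 0 gives continuity there, so the diagonal entries are positive for
  short times. Cutting \<open>t\<close> into equal steps that short, the semigroup property extends
  this to \<open>t\<close>.\<close>

lemma diagonal_pos:
  assumes "0 \<le> t"
  shows "i \<in> set_pmf (p t i)"
proof -
  have "((\<lambda>s. pmf (p s i) i) \<longlongrightarrow> pmf (p 0 i) i) (at_right 0)"
    using generator[of i i] DERIV_continuous continuous_within by blast
  then have "\<forall>\<^sub>F s in at_right 0. pmf (p s i) i > 0"
    by (rule order_tendstoD) (simp add: semigroup_0)
  then obtain e where e: "e > 0" "\<And>s. 0 < s \<Longrightarrow> s < e \<Longrightarrow> pmf (p s i) i > 0"
    unfolding eventually_at_right_field by blast
  obtain n where "t < real n * e"
    using reals_Archimedean3[OF e(1)] by blast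
  also have "real n * e \<le> real (Suc n) * e"
    using e(1) by (intro mult_right_mono) auto
  finally have n: "t < real (Suc n) * e" .
  define s where "s = t / real (Suc n)"
  have s: "0 \<le> s" "s < e" "real (Suc n) * s = t"
    using n assms by (auto simp: s_def field_simps simp del: of_nat_Suc)
  have "i \<in> set_pmf (p s i)"
    using e(2)[of s] s(1,2) by (cases "s = 0") (auto simp: semigroup_0 set_pmf_iff)
  then have "i \<in> set_pmf (p (real k * s) i)" for k
  proof (induction k)
    case (Suc k)
    then show ?case
      using set_pmf_add[of "real k * s" s i i i] s(1) by (simp add: algebra_simps)
  qed (simp add: semigroup_0)
  from this[of "Suc n"] show ?thesis
    by (simp only: s)
qed

text \<open>Some time \<open>t\<close> reaches \<open>j\<close>, and by \<open>diagonal_pos\<close>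
  the chain can again be in \<open>j\<close> at the later grid time
  \<open>real n * \<delta>\<close>.\<close>

lemma irreducible_skeleton:
  assumes "irreducible_ct Pr X" "\<delta> > 0"
  shows "irreducible_dt Pr (\<lambda>k. X (real k * \<delta>))"
  unfolding irreducible_dt_def
proof (intro allI)
  fix i j
  obtain t where t: "t \<ge> 0" "\<P>(\<omega> in Pr i. X t \<omega> = j) > 0"
    using assms(1) unfolding irreducible_ct_def by blast
  then have reach: "j \<in> set_pmf (p t i)"
    by (simp add: prob_state pmf_positive_iff)
  obtain n where "t < real n * \<delta>"
    using reals_Archimedean3[OF assms(2)] by blast
  then have "j \<in> set_pmf (p (real n * \<delta>) i)"
    using set_pmf_add[of t "real n * \<delta> - t" j i j] t(1) reach diagonal_pos[of "real n * \<delta> - t" j] by simp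
  then have "\<P>(\<omega> in Pr i. X (real n * \<delta>) \<omega> = j) > 0"
    using assms(2) by (simp add: prob_state pmf_positive)
  then show "\<exists>n. \<P>(\<omega> in Pr i. X (real n * \<delta>) \<omega> = j) > 0"
    by blast
qed

lemma stationary_skeleton:
  assumes "irreducible_ct Pr X" "stationary_ct p \<pi>" "\<delta> > 0"
  shows "stationary_kernel (p \<delta>) \<pi>"
proof
  show "bind_pmf \<pi> (p \<delta>) = \<pi>"
    using assms by (simp add: stationary_ct_def)
  show "(i, j) \<in> {(x, y). y \<in> set_pmf (p \<delta> x)}\<^sup>*" for i j
    by (rule discrete_time_chain.irreducible_kernel[OF skeleton irreducible_skeleton[OF assms(1)]])
      (rule assms(3))+
qed

text \<open>Right-continuity keeps the path at \<open>j\<close> for a while after every visit, and a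
  fine enough grid has a point in that interval, as close to the visit as desired.\<close>

lemma INF_dyadic_hitting_time:
  assumes "\<omega> \<in> space (Pr i)"
  shows "(INF m. dyadic_hitting_time X j m \<omega>) = hitting_time_ct X j \<omega>"
proof (rule antisym)
  show "hitting_time_ct X j \<omega> \<le> (INF m. dyadic_hitting_time X j m \<omega>)"
    unfolding hitting_time_ct_def dyadic_hitting_time_eq
  proof (intro INF_greatest)
    fix m k
    assume "k \<in> {k. X (real k * (1 / 2 ^ m)) \<omega> = j}"
    then show "(INF t\<in>{t. 0 \<le> t \<and> X t \<omega> = j}. ennreal t) \<le> ennreal (real k * (1 / 2 ^ m))"
      by (intro INF_lower) simp
  qed
  show "(INF m. dyadic_hitting_time X j m \<omega>) \<le> hitting_time_ct X j \<omega>"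
    unfolding hitting_time_ct_def
  proof (rule INF_greatest, rule ennreal_le_epsilon)
    fix t e :: real
    assume "t \<in> {t. 0 \<le> t \<and> X t \<omega> = j}" and e: "0 < e"
    then have t: "0 \<le> t" "X t \<omega> = j"
      by auto
    obtain b where b: "b > t" "\<And>s. t < s \<Longrightarrow> s < b \<Longrightarrow> X s \<omega> = j"
      using right_continuous[OF assms t(1)] t(2) unfolding eventually_at_right_field by blast
    obtain m where m: "(1 / 2) ^ m < min e (b - t)"
      using real_arch_pow_inv[of "min e (b - t)" "1 / 2"] e b(1) by auto
    define d :: real where "d = 1 / 2 ^ m"
    have d: "d > 0" "d < e" "d < b - t"
      using m by (auto simp: d_def power_one_over)
    \<comment> \<open>Rounds \<open>t\<close> up to the grid of mesh \<open>d\<close>.\<close>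
    define k where "k = nat \<lceil>t / d\<rceil>"
    have "real k = of_int \<lceil>t / d\<rceil>"
      using t(1) d(1) by (simp add: k_def)
    then have "t / d \<le> real k" "real k < t / d + 1"
      by linarith+
    then have k: "t \<le> real k * d" "real k * d < t + d"
      using d(1) by (auto simp: field_simps)
    have "X (real k * d) \<omega> = j"
      using b(2)[of "real k * d"] k d(3) t(2) by (cases "real k * d = t") auto
    then have "dyadic_hitting_time X j m \<omega> \<le> ennreal (real k * d)"
      unfolding dyadic_hitting_time_eq d_def by (intro INF_lower) simp
    also have "\<dots> \<le> ennreal (t + e)"
      using k d by (intro ennreal_leI) simp
    finally have "dyadic_hitting_time X j m \<omega> \<le> ennreal t + ennreal e"
      using t(1) e by simp
    then show "(INF m. dyadic_hitting_time X j m \<omega>) \<le> ennreal t + ennreal e"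
      by (rule INF_lower2[OF UNIV_I])
  qed
qed

lemma borel_measurable_dyadic_hitting_time:
  "dyadic_hitting_time X j m \<in> borel_measurable (Pr i)"
proof -
  interpret skeleton: discrete_time_chain "p (1 / 2 ^ m)" Pr "\<lambda>k. X (real k * (1 / 2 ^ m))"
    by (rule skeleton) simp
  show ?thesis
    unfolding dyadic_hitting_time_def
    by (intro borel_measurable_times_ennreal borel_measurable_const skeleton.borel_measurable_hitting_time)
qed

lemma nn_integral_dyadic_hitting_time:
  "(\<integral>\<^sup>+\<omega>. dyadic_hitting_time X j m \<omega> \<partial>Pr i) = ennreal (1 / 2 ^ m) * mean_hit (p (1 / 2 ^ m)) j i"
proof -
  interpret skeleton: discrete_time_chain "p (1 / 2 ^ m)" Pr "\<lambda>k. X (real k * (1 / 2 ^ m))"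
    by (rule skeleton) simp
  show ?thesis
    unfolding dyadic_hitting_time_def
    by (subst nn_integral_cmult[OF skeleton.borel_measurable_hitting_time])
      (simp only: skeleton.nn_integral_hitting_time)
qed

text \<open>Monotone convergence for decreasing functions starts from a finite integral; the
  skeleton of mesh 1 supplies it by \<open>mean_hit_finite\<close>.\<close>

lemma dyadic_hitting_time_LIMSEQ:
  assumes "irreducible_ct Pr X" "stationary_ct p \<pi>"
  shows "(\<lambda>m. \<integral>\<^sup>+\<omega>. dyadic_hitting_time X j m \<omega> \<partial>Pr i) \<longlonglongrightarrow> (\<integral>\<^sup>+\<omega>. hitting_time_ct X j \<omega> \<partial>Pr i)"
    and "(\<integral>\<^sup>+\<omega>. hitting_time_ct X j \<omega> \<partial>Pr i) \<le> (\<integral>\<^sup>+\<omega>. dyadic_hitting_time X j m \<omega> \<partial>Pr i)"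
    and "(\<integral>\<^sup>+\<omega>. hitting_time_ct X j \<omega> \<partial>Pr i) < \<infinity>"
proof -
  define I where "I m = (\<integral>\<^sup>+\<omega>. dyadic_hitting_time X j m \<omega> \<partial>Pr i)" for m
  have fin: "I 0 < \<infinity>"
    using stationary_kernel.mean_hit_finite[OF stationary_skeleton[OF assms, of 1]]
    by (simp add: I_def nn_integral_dyadic_hitting_time)
  have "(\<integral>\<^sup>+\<omega>. hitting_time_ct X j \<omega> \<partial>Pr i) = (\<integral>\<^sup>+\<omega>. (INF m. dyadic_hitting_time X j m \<omega>) \<partial>Pr i)"
    by (intro nn_integral_cong) (simp add: INF_dyadic_hitting_time)
  also have "\<dots> = (INF m. I m)"
    unfolding I_def using fin
    by (intro nn_integral_monotone_convergence_INF_decseq[where i = 0]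
        decseq_dyadic_hitting_time borel_measurable_dyadic_hitting_time) (simp add: I_def)
  finally have eq: "(\<integral>\<^sup>+\<omega>. hitting_time_ct X j \<omega> \<partial>Pr i) = (INF m. I m)" .
  have "dyadic_hitting_time X j (Suc m) \<omega> \<le> dyadic_hitting_time X j m \<omega>" for m \<omega>
    using decseq_SucD[OF decseq_dyadic_hitting_time[of X j], of m] by (simp add: le_fun_def)
  then have "decseq I"
    unfolding I_def by (intro decseq_SucI nn_integral_mono)
  then show "(\<lambda>m. \<integral>\<^sup>+\<omega>. dyadic_hitting_time X j m \<omega> \<partial>Pr i) \<longlonglongrightarrow> (\<integral>\<^sup>+\<omega>. hitting_time_ct X j \<omega> \<partial>Pr i)"
    unfolding eq I_def[symmetric] by (rule LIMSEQ_INF)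
  show le: "(\<integral>\<^sup>+\<omega>. hitting_time_ct X j \<omega> \<partial>Pr i) \<le> (\<integral>\<^sup>+\<omega>. dyadic_hitting_time X j m \<omega> \<partial>Pr i)" for m
    unfolding eq I_def[symmetric] by (rule INF_lower) simp
  show "(\<integral>\<^sup>+\<omega>. hitting_time_ct X j \<omega> \<partial>Pr i) < \<infinity>"
    using le[of 0] fin by (auto simp: I_def intro: le_less_trans)
qed

text \<open>Integrating \<open>mean_hit_drift\<close> against the law at time
  \<open>real n * \<delta>\<close> gives the induction step: one more unit on the left, paid for by
  the probability of being in \<open>j\<close> at that time.\<close>

lemma mean_hit_drift_iterate:
  assumes "irreducible_ct Pr X" "stationary_ct p \<pi>" "\<delta> > 0"
  shows "ennreal (pmf \<pi> j) * ((\<integral>\<^sup>+k. mean_hit (p \<delta>) j k \<partial>p (real n * \<delta>) i) + of_nat n)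
    \<le> ennreal (pmf \<pi> j) * mean_hit (p \<delta>) j i + (\<Sum>k<n. ennreal (pmf (p (real k * \<delta>) i) j))"
proof (induction n)
  case 0
  then show ?case
    by (simp add: semigroup_0)
next
  case (Suc n)
  interpret stationary_kernel "p \<delta>" \<pi>
    by (rule stationary_skeleton[OF assms])
  let ?h = "mean_hit (p \<delta>) j" and ?q = "p (real n * \<delta>) i" and ?w = "ennreal (pmf \<pi> j)"
  have "p (real (Suc n) * \<delta>) i = bind_pmf ?q (p \<delta>)"
    using semigroup_add[of "real n * \<delta>" \<delta> i] assms(3) by (simp add: algebra_simps)
  then have "?w * ((\<integral>\<^sup>+k. ?h k \<partial>p (real (Suc n) * \<delta>) i) + of_nat (Suc n))
      = ?w * ((\<integral>\<^sup>+x. (\<integral>\<^sup>+k. ?h k \<partial>p \<delta> x) \<partial>?q) + 1) + ?w * of_nat n"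
    by (simp add: algebra_simps)
  also have "?w * ((\<integral>\<^sup>+x. (\<integral>\<^sup>+k. ?h k \<partial>p \<delta> x) \<partial>?q) + 1)
      = (\<integral>\<^sup>+x. ?w * ((\<integral>\<^sup>+k. ?h k \<partial>p \<delta> x) + 1) \<partial>?q)"
    by (simp add: nn_integral_cmult nn_integral_add)
  also have "\<dots> \<le> (\<integral>\<^sup>+x. ?w * ?h x + indicator {j} x \<partial>?q)"
    by (intro nn_integral_mono mean_hit_drift)
  also have "\<dots> = ?w * (\<integral>\<^sup>+x. ?h x \<partial>?q) + ennreal (pmf ?q j)"
    by (simp add: nn_integral_cmult nn_integral_add emeasure_pmf_single)
  also have "?w * (\<integral>\<^sup>+x. ?h x \<partial>?q) + ennreal (pmf ?q j) + ?w * of_nat n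
      = ?w * ((\<integral>\<^sup>+x. ?h x \<partial>?q) + of_nat n) + ennreal (pmf ?q j)"
    by (simp add: algebra_simps)
  also have "\<dots> \<le> ?w * ?h i + (\<Sum>k<n. ennreal (pmf (p (real k * \<delta>) i) j)) + ennreal (pmf ?q j)"
    by (intro add_right_mono Suc)
  finally show ?case
    by (simp add: add.assoc add_right_mono)
qed

text \<open>
  The occupation sums \<open>R m j\<close> of the dyadic skeletons add up to \<open>1\<close> over \<open>j\<close>, for every mesh, so
  by Fatou's lemma their limits inferior add up to at most \<open>1\<close>.
\<close>

lemma superharmonic_mean_hitting_time:
  fixes h :: "'s \<Rightarrow> 's \<Rightarrow> ennreal"
  assumes irr: "irreducible_ct Pr X" and stat: "stationary_ct p \<pi>"
  defines "h \<equiv> \<lambda>j i. \<integral>\<^sup>+\<omega>. hitting_time_ct X j \<omega> \<partial>Pr i"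
  defines "K \<equiv> \<lambda>i. \<integral>\<^sup>+j. ennreal (pmf \<pi> j) * h j i \<partial>count_space UNIV"
  shows "(\<integral>\<^sup>+k. K k \<partial>p 1 i) \<le> K i"
proof -
  define H where "H m j i = (\<integral>\<^sup>+\<omega>. dyadic_hitting_time X j m \<omega> \<partial>Pr i)" for m j i
  define R where "R m j = ennreal (1 / 2 ^ m) * (\<Sum>k<2 ^ m. ennreal (pmf (p (real k * (1 / 2 ^ m)) i) j))" for m j
  define a where "a j = ennreal (pmf \<pi> j) * ((\<integral>\<^sup>+k. h j k \<partial>p 1 i) + 1)" for j
  \<comment> \<open>First \<open>h\<close> is bounded by \<open>H m\<close> inside the integral.
    Then \<open>2 ^ m\<close> steps of length \<open>1 / 2 ^ m\<close> make up time 1, and scaling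
    the iterated drift by the mesh turns step counts into time.\<close>
  have a_le: "a j \<le> ennreal (pmf \<pi> j) * H m j i + R m j" for m j
  proof -
    let ?d = "1 / 2 ^ m :: real"
    let ?A = "\<integral>\<^sup>+k. mean_hit (p ?d) j k \<partial>p 1 i"
    have one: "real (2 ^ m) * ?d = 1"
      by simp
    have "a j \<le> ennreal (pmf \<pi> j) * ((\<integral>\<^sup>+k. H m j k \<partial>p 1 i) + 1)"
      unfolding a_def h_def H_def
      by (intro mult_left_mono add_right_mono nn_integral_mono dyadic_hitting_time_LIMSEQ[OF irr stat]) simp
    also have "(\<integral>\<^sup>+k. H m j k \<partial>p 1 i) = ennreal ?d * ?A"
      by (simp add: H_def nn_integral_dyadic_hitting_time nn_integral_cmult)
    also have "ennreal (pmf \<pi> j) * (ennreal ?d * ?A + 1)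
        = ennreal (pmf \<pi> j) * (ennreal ?d * ?A + ennreal ?d * of_nat (2 ^ m))"
      by (simp only: dyadic_unit)
    also have "\<dots> = ennreal ?d * (ennreal (pmf \<pi> j) * (?A + of_nat (2 ^ m)))"
      by (simp only: distrib_left ac_simps)
    also have "\<dots> \<le> ennreal ?d * (ennreal (pmf \<pi> j) * mean_hit (p ?d) j i
        + (\<Sum>k<2 ^ m. ennreal (pmf (p (real k * ?d) i) j)))"
      using mean_hit_drift_iterate[OF irr stat, of ?d j "2 ^ m" i] unfolding one
      by (intro mult_left_mono) simp_all
    also have "\<dots> = ennreal (pmf \<pi> j) * H m j i + R m j"
      unfolding H_def R_def nn_integral_dyadic_hitting_time by (simp only: distrib_left ac_simps)
    finally show ?thesis .
  qed
  have wH_finite: "ennreal (pmf \<pi> j) * H m j i \<noteq> top" for m j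
    using stationary_kernel.mean_hit_finite[OF stationary_skeleton[OF irr stat, of "1 / 2 ^ m"], of j i]
    by (simp add: H_def nn_integral_dyadic_hitting_time ennreal_mult_less_top less_top)
  \<comment> \<open>The finite term with \<open>H m\<close> is subtracted, so that the left side
    converges and only a limit inferior of \<open>R\<close> is taken, with no claim that
    \<open>R\<close> converges.\<close>
  have a_liminf: "a j \<le> ennreal (pmf \<pi> j) * h j i + liminf (\<lambda>m. R m j)" for j
  proof -
    let ?b = "ennreal (pmf \<pi> j) * h j i"
    have b: "?b < top"
      using dyadic_hitting_time_LIMSEQ(3)[OF irr stat, where i = i and j = j]
      by (simp add: h_def ennreal_mult_less_top)
    have "(\<lambda>m. ennreal (pmf \<pi> j) * H m j i) \<longlonglongrightarrow> ?b"
      unfolding h_def H_def using dyadic_hitting_time_LIMSEQ(1,3)[OF irr stat, where i = i and j = j]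
      by (intro tendsto_mult_ennreal tendsto_const) auto
    then have "(\<lambda>m. a j - ennreal (pmf \<pi> j) * H m j i) \<longlonglongrightarrow> a j - ?b"
      using b by (intro tendsto_diff_ennreal_general tendsto_const) auto
    then have "a j - ?b = liminf (\<lambda>m. a j - ennreal (pmf \<pi> j) * H m j i)"
      by (simp add: lim_imp_Liminf)
    also have "\<dots> \<le> liminf (\<lambda>m. R m j)"
      using a_le[of j] wH_finite[of j]
      by (intro Liminf_mono always_eventually allI) (simp add: ennreal_minus_le_iff)
    finally show ?thesis
      using b by (simp add: ennreal_minus_le_iff)
  qed
  have sum_R: "(\<integral>\<^sup>+j. R m j \<partial>count_space UNIV) = 1" for m
    using dyadic_unit[of m]
    by (simp add: R_def nn_integral_cmult nn_integral_sum nn_integral_pmf del: sum_ennreal)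
  have "(\<integral>\<^sup>+k. K k \<partial>p 1 i) + 1 = (\<integral>\<^sup>+j. a j \<partial>count_space UNIV)"
  proof -
    have "(\<integral>\<^sup>+k. K k \<partial>p 1 i) = (\<integral>\<^sup>+j. ennreal (pmf \<pi> j) * (\<integral>\<^sup>+k. h j k \<partial>p 1 i) \<partial>count_space UNIV)"
      unfolding K_def by (rule nn_integral_weighted_sum)
    then show ?thesis
      by (simp add: a_def distrib_left nn_integral_add nn_integral_pmf)
  qed
  also have "\<dots> \<le> (\<integral>\<^sup>+j. ennreal (pmf \<pi> j) * h j i + liminf (\<lambda>m. R m j) \<partial>count_space UNIV)"
    by (intro nn_integral_mono a_liminf)
  also have "\<dots> = K i + (\<integral>\<^sup>+j. liminf (\<lambda>m. R m j) \<partial>count_space UNIV)"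
    by (simp add: K_def nn_integral_add)
  also have "\<dots> \<le> K i + liminf (\<lambda>m. \<integral>\<^sup>+j. R m j \<partial>count_space UNIV)"
    by (intro add_left_mono nn_integral_liminf) simp
  also have "\<dots> = K i + 1"
    by (simp add: sum_R Liminf_const)
  finally show ?thesis
    using ennreal_add_left_cancel_le[of 1] by (simp add: add.commute)
qed

end

section \<open>The dichotomy\<close>

lemma const_dichotomy:
  fixes K :: "'s \<Rightarrow> ennreal"
  assumes "\<And>i k. K i = K k"
  shows "(\<exists>c<\<infinity>. \<forall>i. K i = c) \<or> (\<forall>i. K i = \<infinity>)"
proof (cases "K undefined = \<infinity>")
  case True
  then show ?thesis
    using assms by metis
next
  case False
  then have "K undefined < \<infinity>"
    by (simp add: less_top)
  then show ?thesis
    using assms by blast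
qed

theorem theorem4p1:
  fixes P :: "'s::countable \<Rightarrow> 's pmf"
    and Pr :: "'s \<Rightarrow> 'w measure" and X :: "nat \<Rightarrow> 'w \<Rightarrow> 's"
    and Q :: "'s \<Rightarrow> 's \<Rightarrow> real" and p :: "real \<Rightarrow> 's \<Rightarrow> 's pmf"
    and Pr' :: "'s \<Rightarrow> 'v measure" and Y :: "real \<Rightarrow> 'v \<Rightarrow> 's"
    and \<pi> :: "'s pmf"
  assumes "infinite (UNIV :: 's set)"
  shows
    "(discrete_time_chain P Pr X \<and> irreducible_dt Pr X \<and> positive_recurrent_dt Pr X
        \<and> stationary_dt P \<pi> \<longrightarrow>
      (\<exists>c<\<infinity>. \<forall>i. (\<Sum>\<^sub>\<infinity>j. ennreal (pmf \<pi> j) * (\<integral>\<^sup>+\<omega>. hitting_time_dt X j \<omega> \<partial>Pr i)) = c)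
      \<or> (\<forall>i. (\<Sum>\<^sub>\<infinity>j. ennreal (pmf \<pi> j) * (\<integral>\<^sup>+\<omega>. hitting_time_dt X j \<omega> \<partial>Pr i)) = \<infinity>))
    \<and>
     (continuous_time_chain Q p Pr' Y \<and> irreducible_ct Pr' Y \<and> positive_recurrent_ct Pr' Y
        \<and> stationary_ct p \<pi> \<longrightarrow>
      (\<exists>c<\<infinity>. \<forall>i. (\<Sum>\<^sub>\<infinity>j. ennreal (pmf \<pi> j) * (\<integral>\<^sup>+\<omega>. hitting_time_ct Y j \<omega> \<partial>Pr' i)) = c)
      \<or> (\<forall>i. (\<Sum>\<^sub>\<infinity>j. ennreal (pmf \<pi> j) * (\<integral>\<^sup>+\<omega>. hitting_time_ct Y j \<omega> \<partial>Pr' i)) = \<infinity>))"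
proof (intro conjI impI; elim conjE; rule const_dichotomy;
    unfold infsum_eq_nn_integral[OF assms])
  assume "discrete_time_chain P Pr X" "irreducible_dt Pr X" "stationary_dt P \<pi>"
  then interpret discrete_time_chain P Pr X
    by simp
  interpret stationary_kernel P \<pi>
    using \<open>irreducible_dt Pr X\<close> \<open>stationary_dt P \<pi>\<close>
    by unfold_locales (simp_all add: stationary_dt_def irreducible_kernel)
  show "(\<integral>\<^sup>+j. ennreal (pmf \<pi> j) * (\<integral>\<^sup>+\<omega>. hitting_time_dt X j \<omega> \<partial>Pr i) \<partial>count_space UNIV)
      = (\<integral>\<^sup>+j. ennreal (pmf \<pi> j) * (\<integral>\<^sup>+\<omega>. hitting_time_dt X j \<omega> \<partial>Pr k) \<partial>count_space UNIV)" for i k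
    unfolding nn_integral_hitting_time by (rule superharmonic_const) (rule superharmonic_mean_hit)
next
  assume *: "irreducible_ct Pr' Y" "stationary_ct p \<pi>" and "continuous_time_chain Q p Pr' Y"
  then interpret continuous_time_chain Q p Pr' Y
    by simp
  \<comment> \<open>Superharmonicity at time 1 suffices, since the kernel \<open>p 1\<close> is
    itself irreducible with invariant distribution \<open>\<pi>\<close>.\<close>
  interpret skeleton: stationary_kernel "p 1" \<pi>
    using * by (rule stationary_skeleton) simp
  show "(\<integral>\<^sup>+j. ennreal (pmf \<pi> j) * (\<integral>\<^sup>+\<omega>. hitting_time_ct Y j \<omega> \<partial>Pr' i) \<partial>count_space UNIV)
      = (\<integral>\<^sup>+j. ennreal (pmf \<pi> j) * (\<integral>\<^sup>+\<omega>. hitting_time_ct Y j \<omega> \<partial>Pr' k) \<partial>count_space UNIV)" for i k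
    by (rule skeleton.superharmonic_const) (rule superharmonic_mean_hitting_time[OF *])
qed

end
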